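(* Let $\{G_i\}_{i\in I}$ be an HS-frame for $\mathcal{H}$ with respect to $\mathcal{K}$ with bounds $A,B$, and let $\{H_i\}_{i\in I}$ be a family of bounded linear operators from $\mathcal{H}$ into $\mathcal{C}_2(\mathcal{K})$. Assume there exist constants $\alpha,\beta\in(0,1)$ satisfying $\alpha+\beta=1$, and constants $\lambda_1,\lambda_2\geq 0$ satisfying $\max\{\lambda_1,\lambda_2\}<1$, such that for every finite subset $J\subseteq I$ and for all $x\in\mathcal{H}$, $$\Big\|\sum_{i\in J}(G_i^*G_i x-H_i^*H_i x)\Big\|\leq\lambda_1\Big\|\sum_{i\in J}G_i^*G_i x\Big\|^\alpha\Big\|\sum_{i\in J}H_i^*H_i x\Big\|^\beta+\lambda_2\Big\|\sum_{i\in J}G_i^*G_i x\Big\|^\beta\Big\|\sum_{i\in J}H_i^*H_i x\Big\|^\alpha.$$ Then $\{H_i\}_{i\in I}$ is an HS-frame for $\mathcal{H}$ with respect to $\mathcal{K}$ with (lower and upper, respectively) frame bounds $$A\left(\frac{1-\alpha\lambda_1-\beta\lambda_2}{1+\beta\lambda_1+\alpha\lambda_2}\right)\quad\text{and}\quad B\left(\frac{1+\alpha\lambda_1+\beta\lambda_2}{1-\beta\lambda_1-\alpha\lambda_2}\right).$$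
   Context: $\mathcal{H}$ and $\mathcal{K}$ are separable Hilbert spaces and $I$ is a countable index set. $\mathcal{C}_2(\mathcal{K})$ is the Hilbert-Schmidt class: all compact operators $T$ on $\mathcal{K}$ with $\sum_j\|Te_j\|^2<\infty$, where $\{e_j\}$ is an orthonormal basis of $\mathcal{K}$; it is a Hilbert space with inner product $[T,S]_{\mathrm{tr}}=\mathrm{trace}(S^*T)=\sum_j\langle Te_j,Se_j\rangle$ and norm $\|T\|_2=[T,T]_{\mathrm{tr}}^{1/2}$. For a bounded linear operator $G:\mathcal{H}\to\mathcal{C}_2(\mathcal{K})$, the adjoint $G^*:\mathcal{C}_2(\mathcal{K})\to\mathcal{H}$ is determined by $[Gx,T]_{\mathrm{tr}}=\langle x,G^*T\rangle$ for all $x\in\mathcal{H}$, $T\in\mathcal{C}_2(\mathcal{K})$. A family $\{G_i\}_{i\in I}$ of bounded linear operators from $\mathcal{H}$ into $\mathcal{C}_2(\mathcal{K})$ is a Hilbert-Schmidt frame (HS-frame) for $\mathcal{H}$ with respect to $\mathcal{K}$ with (frame) bounds $A,B$ if $A,B>0$ and $$A\|x\|^2\leq\sum_{i\in I}\|G_ix\|_2^2\leq B\|x\|^2\quad\text{for all }x\in\mathcal{H};$$ $A$ is the lower and $B$ the upper frame bound (bounds are not required to be optimal). *)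

theory Defs
  imports "HOL-Analysis.Analysis"
begin

section \<open>Complex Hilbert spaces\<close>

text \<open>HOL-Analysis only has real inner products, so we add a complex structure on top of
  \<^class>\<open>real_inner\<close>. The complex inner product is linear in its first and conjugate-linear in its
  second argument, and its real part is the underlying real inner product; hence the norm of the
  space is the square root of \<open>cinner x x\<close>.\<close>

class complex_inner = real_inner +
  fixes scaleC :: "complex \<Rightarrow> 'a \<Rightarrow> 'a" (infixr \<open>*\<^sub>C\<close> 75)
    and cinner :: "'a \<Rightarrow> 'a \<Rightarrow> complex"
  assumes scaleC_add_right: "c *\<^sub>C (x + y) = c *\<^sub>C x + c *\<^sub>C y"
    and scaleC_add_left: "(c + d) *\<^sub>C x = c *\<^sub>C x + d *\<^sub>C x"
    and scaleC_scaleC: "c *\<^sub>C (d *\<^sub>C x) = (c * d) *\<^sub>C x"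
    and scaleR_scaleC: "r *\<^sub>R x = complex_of_real r *\<^sub>C x"
    and cinner_commute: "cinner x y = cnj (cinner y x)"
    and cinner_add_left: "cinner (x + y) z = cinner x z + cinner y z"
    and cinner_scaleC_left: "cinner (c *\<^sub>C x) y = c * cinner x y"
    and inner_eq_Re_cinner: "inner x y = Re (cinner x y)"

class chilbert_space = complex_inner + complete_space

definition bounded_clinear :: "('a::complex_inner \<Rightarrow> 'b::complex_inner) \<Rightarrow> bool" where
  "bounded_clinear f \<longleftrightarrow> bounded_linear f \<and> (\<forall>c x. f (c *\<^sub>C x) = c *\<^sub>C f x)"

text \<open>For bounded \<open>G\<close> on a Hilbert space this description determines \<open>cadjoint G T\<close> uniquely,
  see \<open>cinner_cadjoint\<close> below.\<close>

definition cadjoint :: "('a::chilbert_space \<Rightarrow> 'b::complex_inner) \<Rightarrow> 'b \<Rightarrow> 'a" where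
  "cadjoint G T = (THE y. \<forall>x. cinner (G x) T = cinner x y)"

text \<open>An orthonormal basis is a maximal orthonormal set.\<close>

definition orthonormal_basis :: "'a::complex_inner set \<Rightarrow> bool" where
  "orthonormal_basis E \<longleftrightarrow>
     (\<forall>e\<in>E. \<forall>f\<in>E. cinner e f = (if e = f then 1 else 0)) \<and>
     (\<forall>x. (\<forall>e\<in>E. cinner x e = 0) \<longrightarrow> x = 0)"

definition compact_operator :: "('a::complex_inner \<Rightarrow> 'b::complex_inner) \<Rightarrow> bool" where
  "compact_operator T \<longleftrightarrow>
     bounded_clinear T \<and> (\<forall>S. bounded S \<longrightarrow> compact (closure (T ` S)))"

subsection \<open>Elementary consequences\<close>

lemma cinner_add_right: "cinner x (y + z) = cinner x y + cinner x (z::'a::complex_inner)"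
  by (metis cinner_add_left cinner_commute complex_cnj_add)

lemma cinner_scaleC_right: "cinner x (c *\<^sub>C y) = cnj c * cinner x (y::'a::complex_inner)"
  by (metis cinner_scaleC_left cinner_commute complex_cnj_mult)

lemma scaleC_zero_right [simp]: "c *\<^sub>C 0 = (0::'a::complex_inner)"
  by (metis add_cancel_right_right scaleC_add_right)

lemma scaleC_zero_left [simp]: "0 *\<^sub>C x = (0::'a::complex_inner)"
  by (metis add_cancel_right_right scaleC_add_left)

lemma scaleC_one [simp]: "1 *\<^sub>C x = (x::'a::complex_inner)"
  using scaleR_scaleC[of 1 x] by simp

lemma scaleC_minus_one: "(-1) *\<^sub>C x = - (x::'a::complex_inner)"
  using scaleR_scaleC[of "-1" x] by simp

lemma cinner_zero_left [simp]: "cinner 0 (y::'a::complex_inner) = 0"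
  by (metis add_cancel_right_right cinner_add_left)

lemma cinner_zero_right [simp]: "cinner (x::'a::complex_inner) 0 = 0"
  by (metis add_cancel_right_right cinner_add_right)

lemma cinner_minus_left: "cinner (- x) y = - cinner x (y::'a::complex_inner)"
  using cinner_add_left[of x "-x" y] by (simp add: eq_neg_iff_add_eq_0 add.commute)

lemma cinner_minus_right: "cinner x (- y) = - cinner x (y::'a::complex_inner)"
  using cinner_add_right[of x y "-y"] by (simp add: eq_neg_iff_add_eq_0 add.commute)

lemma cinner_diff_left: "cinner (x - y) z = cinner x z - cinner y (z::'a::complex_inner)"
  using cinner_add_left[of x "-y" z] by (simp add: cinner_minus_left)

lemma cinner_diff_right: "cinner x (y - z) = cinner x y - cinner x (z::'a::complex_inner)"
  using cinner_add_right[of x y "-z"] by (simp add: cinner_minus_right)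

lemma cinner_self: "cinner x x = complex_of_real ((norm (x::'a::complex_inner))\<^sup>2)"
proof -
  have "Im (cinner x x) = 0"
    by (metis cinner_commute Reals_cnj_iff complex_is_Real_iff)
  then show ?thesis
    by (simp add: complex_eq_iff power2_norm_eq_inner inner_eq_Re_cinner)
qed

lemma cinner_self_eq_0 [simp]: "cinner x x = 0 \<longleftrightarrow> x = (0::'a::complex_inner)"
  by (simp add: cinner_self)

lemma Im_cinner: "Im (cinner x y) = inner x (\<i> *\<^sub>C (y::'a::complex_inner))"
  by (simp add: inner_eq_Re_cinner cinner_scaleC_right)

lemma norm_scaleC: "norm (c *\<^sub>C x) = cmod c * norm (x::'a::complex_inner)"
proof -
  have "complex_of_real ((norm (c *\<^sub>C x))\<^sup>2) = c * cnj c * complex_of_real ((norm x)\<^sup>2)"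
    by (metis cinner_self cinner_scaleC_left cinner_scaleC_right mult.assoc)
  also have "\<dots> = complex_of_real ((cmod c * norm x)\<^sup>2)"
    by (simp add: complex_norm_square power_mult_distrib flip: of_real_power)
  finally have "(norm (c *\<^sub>C x))\<^sup>2 = (cmod c * norm x)\<^sup>2"
    using of_real_eq_iff by blast
  then show ?thesis by simp
qed

lemma cmod_cinner_le: "cmod (cinner x y) \<le> (norm x)\<^sup>2 + (norm (y::'a::complex_inner))\<^sup>2"
proof -
  have "\<bar>Re (cinner x y)\<bar> \<le> norm x * norm y"
    using Cauchy_Schwarz_ineq2[of x y] by (simp add: inner_eq_Re_cinner)
  moreover have "\<bar>Im (cinner x y)\<bar> \<le> norm x * norm y"
    using Cauchy_Schwarz_ineq2[of x "\<i> *\<^sub>C y"] by (simp add: Im_cinner norm_scaleC)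
  moreover have "2 * (norm x * norm y) \<le> (norm x)\<^sup>2 + (norm y)\<^sup>2"
    using sum_squares_bound[of "norm x" "norm y"] by simp
  ultimately show ?thesis
    using cmod_le[of "cinner x y"] by linarith
qed

lemma bounded_clinear_imp_bounded_linear: "bounded_clinear f \<Longrightarrow> bounded_linear f"
  by (simp add: bounded_clinear_def)

lemma bounded_clinear_scaleC: "bounded_clinear f \<Longrightarrow> f (c *\<^sub>C x) = c *\<^sub>C f x"
  by (simp add: bounded_clinear_def)

lemma bounded_clinear_const_scaleC: "bounded_clinear (\<lambda>x::'a::complex_inner. c *\<^sub>C x)"
  unfolding bounded_clinear_def
  by (auto intro!: bounded_linear_intro[of _ "cmod c"]
      simp: scaleC_add_right scaleR_scaleC scaleC_scaleC norm_scaleC mult.commute)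

subsection \<open>Projections, orthonormal bases and adjoints\<close>

lemma orthogonal_projection_exists:
  fixes N :: "'a::{real_inner,complete_space} set"
  assumes N: "subspace N" "closed N"
  shows "\<exists>p\<in>N. \<forall>n\<in>N. inner n (x - p) = 0"
proof -
  define d where "d = infdist x N"
  have ne: "N \<noteq> {}" using N(1) subspace_0 by auto
  have dle: "d \<le> norm (x - n)" if "n \<in> N" for n
    using infdist_le[OF that, of x] by (simp add: d_def dist_norm)
  have d0: "d \<ge> 0" by (simp add: d_def infdist_nonneg)
  have "\<exists>n\<in>N. norm (x - n) < d + 1 / Suc k" for k :: nat
  proof (rule ccontr)
    assume "\<not> ?thesis"
    then have "d + 1 / Suc k \<le> infdist x N"
      by (auto simp: infdist_notempty[OF ne] dist_norm not_less intro!: cINF_greatest[OF ne])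
    then have "1 / real (Suc k) \<le> 0" unfolding d_def by linarith
    then show False by simp
  qed
  then obtain u where u: "\<And>k. u k \<in> N" "\<And>k. norm (x - u k) < d + 1 / Suc k" by metis
  have mid: "(norm (u j - u k))\<^sup>2 \<le> 2 * (norm (x - u j))\<^sup>2 + 2 * (norm (x - u k))\<^sup>2 - 4 * d\<^sup>2" for j k
  proof -
    have "(1/2) *\<^sub>R (u j + u k) \<in> N"
      using N u by (intro subspace_scale subspace_add)
    from dle[OF this] have "d\<^sup>2 \<le> (norm (x - (1/2) *\<^sub>R (u j + u k)))\<^sup>2"
      using d0 by (rule power_mono)
    then show ?thesis
      by (simp add: power2_norm_eq_inner inner_diff_left inner_diff_right inner_add_left
          inner_add_right inner_commute algebra_simps)
  qed
  have lim: "(\<lambda>k. norm (x - u k)) \<longlonglongrightarrow> d"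
  proof (rule tendsto_sandwich[of "\<lambda>_. d" _ _ "\<lambda>k. d + 1 / Suc k"])
    show "(\<lambda>k. d + 1 / Suc k) \<longlonglongrightarrow> d"
      using tendsto_add[OF tendsto_const LIMSEQ_inverse_real_of_nat, of d]
      by (simp add: inverse_eq_divide)
  qed (use u dle in \<open>auto intro!: always_eventually less_imp_le\<close>)
  have "Cauchy u"
  proof (rule metric_CauchyI)
    fix e :: real assume e: "e > 0"
    have "(\<lambda>k. 2 * (norm (x - u k))\<^sup>2) \<longlonglongrightarrow> 2 * d\<^sup>2"
      by (intro tendsto_intros lim)
    then have "eventually (\<lambda>k. 2 * (norm (x - u k))\<^sup>2 < 2 * d\<^sup>2 + e\<^sup>2 / 2) sequentially"
      by (rule order_tendstoD(2)) (use e in simp)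
    then obtain M where M: "\<And>k. k \<ge> M \<Longrightarrow> 2 * (norm (x - u k))\<^sup>2 < 2 * d\<^sup>2 + e\<^sup>2 / 2"
      by (auto simp: eventually_sequentially)
    show "\<exists>M. \<forall>m\<ge>M. \<forall>n\<ge>M. dist (u m) (u n) < e"
    proof (intro exI allI impI)
      fix m n assume "m \<ge> M" "n \<ge> M"
      then have "(norm (u m - u n))\<^sup>2 < e\<^sup>2"
        using mid[of m n] M[of m] M[of n] by linarith
      then show "dist (u m) (u n) < e"
        using e by (simp add: dist_norm power2_less_imp_less)
    qed
  qed
  then obtain p where p: "u \<longlonglongrightarrow> p"
    using Cauchy_convergent convergent_def by blast
  have pN: "p \<in> N"
    using closed_sequentially[OF N(2)] u(1) p by blast
  have nd: "norm (x - p) = d"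
    by (rule LIMSEQ_unique[OF _ lim]) (intro tendsto_intros p)
  have "inner n (x - p) = 0" if n: "n \<in> N" for n
  proof (cases "n = 0")
    case False
    define t where "t = inner n (x - p) / inner n n"
    have nn: "inner n n > 0" using False by simp
    have "p + t *\<^sub>R n \<in> N" using N n pN by (intro subspace_add subspace_scale)
    from dle[OF this] have "(norm (x - p))\<^sup>2 \<le> (norm ((x - p) - t *\<^sub>R n))\<^sup>2"
      unfolding nd[symmetric] by (intro power_mono) (auto simp: algebra_simps)
    also have "\<dots> = (norm (x - p))\<^sup>2 - 2 * t * inner n (x - p) + t * t * inner n n"
      unfolding power2_norm_eq_inner
      by (simp add: inner_diff_left[of "x - p"] inner_diff_right[of _ "x - p"] inner_commute algebra_simps)
    also have "\<dots> = (norm (x - p))\<^sup>2 - (inner n (x - p))\<^sup>2 / inner n n"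
      using nn by (simp add: t_def field_simps power2_eq_square)
    finally have "(inner n (x - p))\<^sup>2 / inner n n \<le> 0" by simp
    then show ?thesis using nn by (simp add: divide_le_0_iff)
  qed simp
  with pN show ?thesis by blast
qed

lemma kernel_projection_exists:
  fixes f :: "'a::chilbert_space \<Rightarrow> 'b::real_normed_vector"
  assumes f: "bounded_linear f" and sc: "\<And>x. f x = 0 \<Longrightarrow> f (\<i> *\<^sub>C x) = 0"
  shows "\<exists>p. f p = 0 \<and> (\<forall>n. f n = 0 \<longrightarrow> cinner n (x - p) = 0)"
proof -
  interpret f: bounded_linear f by fact
  have "subspace {x. f x = 0}"
    by (auto simp: subspace_def f.add f.scaleR f.zero)
  moreover have "closed {x. f x = 0}"
    using continuous_closed_vimage[of "{0}" f] f.isCont[OF continuous_ident]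
    by (simp add: vimage_def)
  ultimately obtain p where p: "f p = 0" "\<And>n. f n = 0 \<Longrightarrow> inner n (x - p) = 0"
    using orthogonal_projection_exists[of "{x. f x = 0}" x] by auto
  have "cinner n (x - p) = 0" if n: "f n = 0" for n
  proof -
    have "Re (cinner n (x - p)) = 0" using p(2)[OF n] by (simp add: inner_eq_Re_cinner)
    moreover have "Im (cinner n (x - p)) = 0"
      using p(2)[OF sc[OF n]] by (simp add: inner_eq_Re_cinner cinner_scaleC_left)
    ultimately show ?thesis by (simp add: complex_eq_iff)
  qed
  with p show ?thesis by blast
qed

lemma bounded_clinear_eq_0_on_basis:
  fixes T :: "'a::chilbert_space \<Rightarrow> 'b::complex_inner"
  assumes T: "bounded_clinear T" and E: "orthonormal_basis E" and 0: "\<And>e. e \<in> E \<Longrightarrow> T e = 0"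
  shows "T x = 0"
proof -
  obtain p where p: "T p = 0" "\<And>n. T n = 0 \<Longrightarrow> cinner n (x - p) = 0"
    using kernel_projection_exists[of T x] T by (force simp: bounded_clinear_def)
  have "cinner (x - p) e = 0" if "e \<in> E" for e
    using p(2)[OF 0[OF that]] cinner_commute[of "x - p" e] by simp
  then have "x - p = 0" using E unfolding orthonormal_basis_def by blast
  with p show ?thesis by simp
qed

lemma orthonormal_basis_exists: "\<exists>E :: 'a::complex_inner set. orthonormal_basis E"
proof -
  let ?on = "\<lambda>E :: 'a set. \<forall>e\<in>E. \<forall>f\<in>E. cinner e f = (if e = f then 1 else 0)"
  have "\<exists>M\<in>Collect ?on. \<forall>X\<in>Collect ?on. M \<subseteq> X \<longrightarrow> X = M"
  proof (rule subset_Zorn')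
    fix C assume C: "subset.chain (Collect ?on) C"
    show "\<Union>C \<in> Collect ?on"
    proof (intro CollectI ballI)
      fix e f assume "e \<in> \<Union>C" "f \<in> \<Union>C"
      then obtain X Y where XY: "X \<in> C" "Y \<in> C" "e \<in> X" "f \<in> Y" by auto
      then have "X \<subseteq> Y \<or> Y \<subseteq> X" using C by (auto simp: subset_chain_def)
      then obtain Z where "Z \<in> C" "e \<in> Z" "f \<in> Z" using XY by auto
      moreover from this have "?on Z" using C by (auto simp: subset_chain_def)
      ultimately show "cinner e f = (if e = f then 1 else 0)" by blast
    qed
  qed
  then obtain E where E: "?on E" "\<And>X. ?on X \<Longrightarrow> E \<subseteq> X \<Longrightarrow> X = E" by auto
  have "x = 0" if x: "\<forall>e\<in>E. cinner x e = 0" for x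
  proof (rule ccontr)
    assume nz: "x \<noteq> 0"
    define y where "y = complex_of_real (1 / norm x) *\<^sub>C x"
    have y1: "cinner y y = 1"
      using nz cinner_self[of x]
      by (simp add: y_def cinner_scaleC_left cinner_scaleC_right power2_eq_square del: cinner_self_eq_0)
    have y2: "cinner y e = 0" if "e \<in> E" for e
      using x that by (simp add: y_def cinner_scaleC_left)
    have y3: "cinner e y = 0" if "e \<in> E" for e
      using y2[OF that] cinner_commute[of e y] by simp
    have "y \<notin> E" using y1 y2 by fastforce
    have "?on (insert y E)"
      using E(1) y1 y2 y3 \<open>y \<notin> E\<close> by (auto split: if_splits)
    then have "insert y E = E" using E(2) by blast
    with \<open>y \<notin> E\<close> show False by blast
  qed
  with E(1) show ?thesis unfolding orthonormal_basis_def by blast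
qed

lemma cinner_cadjoint:
  fixes G :: "'a::chilbert_space \<Rightarrow> 'b::complex_inner"
  assumes G: "bounded_clinear G"
  shows "cinner (G x) T = cinner x (cadjoint G T)"
proof -
  interpret G: bounded_linear G using G by (simp add: bounded_clinear_def)
  define f where "f x = cinner (G x) T" for x
  have f_add: "f (x + y) = f x + f y" and f_sc: "f (c *\<^sub>C x) = c * f x" for x y c
    using G by (simp_all add: f_def G.add cinner_add_left bounded_clinear_scaleC cinner_scaleC_left)
  have f_diff: "f (x - y) = f x - f y" for x y
    by (simp add: f_def G.diff cinner_diff_left)
  have Re: "bounded_linear (\<lambda>x. inner (G x) T)"
    by (intro bounded_linear_compose[OF bounded_linear_inner_left G.bounded_linear_axioms])
  have Im: "bounded_linear (\<lambda>x. inner (G x) (\<i> *\<^sub>C T))"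
    by (intro bounded_linear_compose[OF bounded_linear_inner_left G.bounded_linear_axioms])
  have f_eq: "f = (\<lambda>x. inner (G x) T *\<^sub>R 1 + inner (G x) (\<i> *\<^sub>C T) *\<^sub>R \<i>)"
    by (rule ext, rule complex_eqI)
      (simp_all add: f_def inner_eq_Re_cinner Im_cinner[symmetric] cinner_scaleC_right)
  have f: "bounded_linear f"
    unfolding f_eq
    by (intro bounded_linear_add bounded_linear_scaleR_const Re Im)
  have "\<exists>y. \<forall>x. f x = cinner x y"
  proof (cases "\<forall>x. f x = 0")
    case True
    then show ?thesis by (intro exI[of _ 0]) simp
  next
    case False
    then obtain x0 where x0: "f x0 \<noteq> 0" by blast
    obtain p where p: "f p = 0" "\<And>n. f n = 0 \<Longrightarrow> cinner n (x0 - p) = 0"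
      using kernel_projection_exists[OF f, of x0] by (auto simp: f_sc)
    define z where "z = x0 - p"
    have fz: "f z \<noteq> 0" using x0 p by (simp add: z_def f_diff)
    then have z0: "cinner z z \<noteq> 0" using f_sc[of 0 0] by auto
    have "f x = cinner x (cnj (f z / cinner z z) *\<^sub>C z)" for x
    proof -
      have "f (f z *\<^sub>C x - f x *\<^sub>C z) = 0"
        by (simp add: f_diff f_sc)
      then have "f z * cinner x z = f x * cinner z z"
        using p(2) by (fastforce simp: z_def[symmetric] cinner_diff_left cinner_scaleC_left)
      then show ?thesis using z0 by (simp add: cinner_scaleC_right field_simps)
    qed
    then show ?thesis by blast
  qed
  then obtain y where y: "\<forall>x. f x = cinner x y" by blast
  have "\<forall>x. cinner (G x) T = cinner x (cadjoint G T)"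
    unfolding cadjoint_def
  proof (rule theI)
    show "\<forall>x. cinner (G x) T = cinner x y" using y by (simp add: f_def)
    fix y' assume y': "\<forall>x. cinner (G x) T = cinner x y'"
    have "cinner (y' - y) (y' - y) = 0"
      using y y' by (metis cinner_diff_right f_def right_minus_eq)
    then show "y' = y" by simp
  qed
  then show ?thesis by blast
qed

section \<open>The Hilbert-Schmidt class\<close>

text \<open>An arbitrary orthonormal basis of the space, fixed once and for all; as is well known, the
  Hilbert-Schmidt class and its inner product do not depend on the choice.\<close>

definition hs_basis :: "'k::chilbert_space set" where
  "hs_basis = (SOME E. orthonormal_basis E)"

lemma orthonormal_basis_hs_basis: "orthonormal_basis (hs_basis :: 'k::chilbert_space set)"
  unfolding hs_basis_def by (rule someI_ex[OF orthonormal_basis_exists])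

definition hilbert_schmidt :: "('k::chilbert_space \<Rightarrow> 'k) \<Rightarrow> bool" where
  "hilbert_schmidt T \<longleftrightarrow>
     compact_operator T \<and> (\<lambda>e. (norm (T e))\<^sup>2) summable_on hs_basis"

lemma compact_operator_zero: "compact_operator (\<lambda>_::'a::complex_inner. 0 :: 'b::complex_inner)"
proof -
  have "compact (closure ((\<lambda>_. 0 :: 'b::complex_inner) ` S))" for S :: "'a set"
    by (cases "S = {}") (simp_all add: image_constant_conv)
  then show ?thesis
    by (simp add: compact_operator_def bounded_clinear_def)
qed

lemma compact_operator_add:
  assumes "compact_operator T" "compact_operator S"
  shows "compact_operator (\<lambda>x. T x + S x)"
  unfolding compact_operator_def
proof (intro conjI allI impI)
  show "bounded_clinear (\<lambda>x. T x + S x)"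
    using assms
    by (auto simp: compact_operator_def bounded_clinear_def scaleC_add_right
        intro: bounded_linear_add)
  fix X :: "'a set" assume X: "bounded X"
  let ?C = "{x + y | x y. x \<in> closure (T ` X) \<and> y \<in> closure (S ` X)}"
  have C: "compact ?C"
    using assms X by (intro compact_sums) (auto simp: compact_operator_def)
  have "closure ((\<lambda>x. T x + S x) ` X) \<subseteq> ?C"
  proof (rule closure_minimal)
    show "(\<lambda>x. T x + S x) ` X \<subseteq> ?C"
      using closure_subset[of "T ` X"] closure_subset[of "S ` X"] by blast
    show "closed ?C" using C by (rule compact_imp_closed)
  qed
  then show "compact (closure ((\<lambda>x. T x + S x) ` X))"
    using compact_Int_closed[OF C closed_closure[of "(\<lambda>x. T x + S x) ` X"]] by (simp add: Int_absorb1)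
qed

lemma compact_operator_scaleC:
  assumes "compact_operator T"
  shows "compact_operator (\<lambda>x. c *\<^sub>C T x)"
  unfolding compact_operator_def
proof (intro conjI allI impI)
  have bc: "bounded_linear (\<lambda>x::'b. c *\<^sub>C x)"
    using bounded_clinear_const_scaleC by (rule bounded_clinear_imp_bounded_linear)
  show "bounded_clinear (\<lambda>x. c *\<^sub>C T x)"
    using assms bounded_linear_compose[OF bc]
    by (auto simp: compact_operator_def bounded_clinear_def scaleC_scaleC mult.commute)
  fix X :: "'a set" assume X: "bounded X"
  let ?C = "(\<lambda>x. c *\<^sub>C x) ` closure (T ` X)"
  have C: "compact ?C"
    using assms X bc
    by (intro compact_continuous_image linear_continuous_on) (auto simp: compact_operator_def)
  have "closure ((\<lambda>x. c *\<^sub>C T x) ` X) \<subseteq> ?C"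
  proof (rule closure_minimal)
    show "(\<lambda>x. c *\<^sub>C T x) ` X \<subseteq> ?C"
      using closure_subset[of "T ` X"] by blast
    show "closed ?C" using C by (rule compact_imp_closed)
  qed
  then show "compact (closure ((\<lambda>x. c *\<^sub>C T x) ` X))"
    using compact_Int_closed[OF C closed_closure[of "(\<lambda>x. c *\<^sub>C T x) ` X"]] by (simp add: Int_absorb1)
qed

lemma hilbert_schmidt_zero: "hilbert_schmidt (\<lambda>_. 0)"
  by (simp add: hilbert_schmidt_def compact_operator_zero)

lemma hilbert_schmidt_add:
  assumes "hilbert_schmidt T" "hilbert_schmidt S"
  shows "hilbert_schmidt (\<lambda>x. T x + S x)"
proof -
  have "(\<lambda>e. 2 * (norm (T e))\<^sup>2 + 2 * (norm (S e))\<^sup>2) summable_on hs_basis"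
    using assms
    by (intro summable_on_add summable_on_cmult_right) (auto simp: hilbert_schmidt_def)
  then have "(\<lambda>e. (norm (T e + S e))\<^sup>2) summable_on hs_basis"
  proof (rule summable_on_comparison_test)
    fix e :: 'a
    have "(norm (T e + S e))\<^sup>2 + (norm (T e - S e))\<^sup>2 = 2 * (norm (T e))\<^sup>2 + 2 * (norm (S e))\<^sup>2"
      by (simp add: power2_norm_eq_inner inner_add_left inner_add_right inner_diff_left
          inner_diff_right)
    then show "(norm (T e + S e))\<^sup>2 \<le> 2 * (norm (T e))\<^sup>2 + 2 * (norm (S e))\<^sup>2"
      using zero_le_power2[of "norm (T e - S e)"] by linarith
  qed simp
  with assms show ?thesis by (simp add: hilbert_schmidt_def compact_operator_add)
qed

lemma hilbert_schmidt_scaleC: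
  assumes "hilbert_schmidt T"
  shows "hilbert_schmidt (\<lambda>x. c *\<^sub>C T x)"
proof -
  have "(\<lambda>e. (cmod c)\<^sup>2 * (norm (T e))\<^sup>2) summable_on hs_basis"
    using assms by (intro summable_on_cmult_right) (simp add: hilbert_schmidt_def)
  with assms show ?thesis
    by (simp add: hilbert_schmidt_def compact_operator_scaleC norm_scaleC power_mult_distrib)
qed

typedef (overloaded) 'k hs = "{T :: 'k::chilbert_space \<Rightarrow> 'k. hilbert_schmidt T}"
  morphisms hs_apply Abs_hs
  using hilbert_schmidt_zero by blast

setup_lifting type_definition_hs

lemma hilbert_schmidt_hs_apply: "hilbert_schmidt (hs_apply T)"
  using hs_apply by auto

text \<open>The trace inner product of \<open>T\<close> and \<open>S\<close> is the trace of \<open>S\<^sup>* T\<close>, that is, the sum of \<open>\<langle>T e, S e\<rangle>\<close> over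
  the basis.\<close>

instantiation hs :: (chilbert_space) complex_inner
begin

lift_definition zero_hs :: "'a hs" is "\<lambda>_. 0"
  by (rule hilbert_schmidt_zero)

lift_definition plus_hs :: "'a hs \<Rightarrow> 'a hs \<Rightarrow> 'a hs" is "\<lambda>T S x. T x + S x"
  by (rule hilbert_schmidt_add)

lift_definition scaleC_hs :: "complex \<Rightarrow> 'a hs \<Rightarrow> 'a hs" is "\<lambda>c T x. c *\<^sub>C T x"
  by (rule hilbert_schmidt_scaleC)

definition uminus_hs :: "'a hs \<Rightarrow> 'a hs" where "- T = (-1) *\<^sub>C (T :: 'a hs)"

definition minus_hs :: "'a hs \<Rightarrow> 'a hs \<Rightarrow> 'a hs" where "T - S = T + - (S::'a hs)"

definition scaleR_hs :: "real \<Rightarrow> 'a hs \<Rightarrow> 'a hs" where "r *\<^sub>R T = complex_of_real r *\<^sub>C (T :: 'a hs)"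

definition cinner_hs :: "'a hs \<Rightarrow> 'a hs \<Rightarrow> complex" where
  "cinner T S = (\<Sum>\<^sub>\<infinity>e\<in>hs_basis. cinner (hs_apply T e) (hs_apply S e))"

definition inner_hs :: "'a hs \<Rightarrow> 'a hs \<Rightarrow> real" where "inner T S = Re (cinner T (S :: 'a hs))"

definition norm_hs :: "'a hs \<Rightarrow> real" where "norm T = sqrt (Re (cinner T (T :: 'a hs)))"

definition sgn_hs :: "'a hs \<Rightarrow> 'a hs" where "sgn T = inverse (norm T) *\<^sub>R (T :: 'a hs)"

definition dist_hs :: "'a hs \<Rightarrow> 'a hs \<Rightarrow> real" where "dist T S = norm (T - (S :: 'a hs))"

definition uniformity_hs :: "('a hs \<times> 'a hs) filter" where
  "uniformity_hs = (INF e\<in>{0<..}. principal {(T, S). dist T S < e})"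

definition open_hs :: "'a hs set \<Rightarrow> bool" where
  "open_hs U \<longleftrightarrow> (\<forall>T\<in>U. eventually (\<lambda>(T', S). T' = T \<longrightarrow> S \<in> U) uniformity)"

instance
proof
  fix T S R :: "'a hs" and a b :: real and c d :: complex and U :: "'a hs set"
  have summ: "(\<lambda>e. cinner (hs_apply P e) (hs_apply Q e)) summable_on hs_basis" for P Q :: "'a hs"
  proof -
    have "(\<lambda>e. (norm (hs_apply P e))\<^sup>2 + (norm (hs_apply Q e))\<^sup>2) summable_on hs_basis"
      using hilbert_schmidt_hs_apply[of P] hilbert_schmidt_hs_apply[of Q]
      by (intro summable_on_add) (auto simp: hilbert_schmidt_def)
    then have "(\<lambda>e. norm (cinner (hs_apply P e) (hs_apply Q e))) summable_on hs_basis"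
      by (rule summable_on_comparison_test) (auto simp: cmod_cinner_le)
    then show ?thesis by (rule abs_summable_summable)
  qed
  show "T + S + R = T + (S + R)" by transfer (simp add: add.assoc)
  show "T + S = S + T" by transfer (simp add: add.commute)
  show "0 + T = T" by transfer simp
  show "- T + T = 0" unfolding uminus_hs_def by transfer (simp add: scaleC_minus_one)
  show "T - S = T + - S" by (rule minus_hs_def)
  show "a *\<^sub>R (T + S) = a *\<^sub>R T + a *\<^sub>R S"
    unfolding scaleR_hs_def by transfer (simp add: scaleC_add_right)
  show "(a + b) *\<^sub>R T = a *\<^sub>R T + b *\<^sub>R T"
    unfolding scaleR_hs_def by transfer (simp add: scaleC_add_left)
  show "a *\<^sub>R b *\<^sub>R T = (a * b) *\<^sub>R T"
    unfolding scaleR_hs_def by transfer (simp add: scaleC_scaleC)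
  show "1 *\<^sub>R T = T"
    unfolding scaleR_hs_def by transfer simp
  show "sgn T = inverse (norm T) *\<^sub>R T" by (rule sgn_hs_def)
  show "dist T S = norm (T - S)" by (rule dist_hs_def)
  show "uniformity = (INF e\<in>{0<..}. principal {(T::'a hs, S). dist T S < e})"
    by (rule uniformity_hs_def)
  show "open U \<longleftrightarrow> (\<forall>x\<in>U. eventually (\<lambda>(x', y). x' = x \<longrightarrow> y \<in> U) uniformity)"
    by (rule open_hs_def)
  show "c *\<^sub>C (T + S) = c *\<^sub>C T + c *\<^sub>C S"
    by transfer (simp add: scaleC_add_right)
  show "(c + d) *\<^sub>C T = c *\<^sub>C T + d *\<^sub>C T"
    by transfer (simp add: scaleC_add_left)
  show "c *\<^sub>C d *\<^sub>C T = (c * d) *\<^sub>C T"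
    by transfer (simp add: scaleC_scaleC)
  show "a *\<^sub>R T = complex_of_real a *\<^sub>C T" by (rule scaleR_hs_def)
  show comm: "cinner T S = cnj (cinner S T)"
    unfolding cinner_hs_def infsum_cnj[symmetric]
    by (rule infsum_cong) (rule cinner_commute)
  show cadd: "cinner (T + S) R = cinner T R + cinner S R"
    unfolding cinner_hs_def
    by (subst infsum_add[symmetric, OF summ summ]) (simp add: plus_hs.rep_eq cinner_add_left)
  show csc: "cinner (c *\<^sub>C T) S = c * cinner T S" for c and T S :: "'a hs"
    unfolding cinner_hs_def
    by (simp add: scaleC_hs.rep_eq cinner_scaleC_left infsum_cmult_right')
  show "inner T S = Re (cinner T S)" by (rule inner_hs_def)
  show "inner T S = inner S T"
    unfolding inner_hs_def by (simp add: comm)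
  show "inner (T + S) R = inner T R + inner S R"
    by (simp add: inner_hs_def cadd)
  show "inner (a *\<^sub>R T) S = a * inner T S"
    by (simp add: inner_hs_def scaleR_hs_def csc)
  have inn: "inner T T = (\<Sum>\<^sub>\<infinity>e\<in>hs_basis. (norm (hs_apply T e))\<^sup>2)"
    unfolding inner_hs_def cinner_hs_def infsum_Re[OF summ, symmetric]
    by (rule infsum_cong) (simp add: cinner_self)
  show "0 \<le> inner T T" unfolding inn by (rule infsum_nonneg) simp
  show "norm T = sqrt (inner T T)" by (simp add: norm_hs_def inner_hs_def)
  show "inner T T = 0 \<longleftrightarrow> T = 0"
  proof
    assume "T = 0"
    then show "inner T T = 0" unfolding inn by (simp add: zero_hs.rep_eq)
  next
    assume 0: "inner T T = 0"
    have hs: "hilbert_schmidt (hs_apply T)" by (rule hilbert_schmidt_hs_apply)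
    have "hs_apply T e = 0" if "e \<in> hs_basis" for e
    proof -
      have "(norm (hs_apply T e))\<^sup>2 = 0"
        using hs 0 that unfolding inn
        by (intro nonneg_infsum_le_0D[of "\<lambda>e. (norm (hs_apply T e))\<^sup>2" hs_basis])
          (auto simp: hilbert_schmidt_def)
      then show ?thesis by simp
    qed
    then have "hs_apply T x = 0" for x
      using bounded_clinear_eq_0_on_basis[OF _ orthonormal_basis_hs_basis, of "hs_apply T" x] hs
      by (simp add: hilbert_schmidt_def compact_operator_def)
    then show "T = 0"
      by (metis (no_types, lifting) ext hs_apply_inject zero_hs.rep_eq)
  qed
qed

end

section \<open>Hilbert-Schmidt frames\<close>

text \<open>Summability has to be required explicitly, since \<^const>\<open>infsum\<close> is \<open>0\<close> for divergent sums.\<close>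

definition hs_frame ::
  "'i set \<Rightarrow> ('i \<Rightarrow> 'h::chilbert_space \<Rightarrow> 'k::chilbert_space hs) \<Rightarrow> real \<Rightarrow> real \<Rightarrow> bool" where
  "hs_frame I G A B \<longleftrightarrow>
     (\<forall>i\<in>I. bounded_clinear (G i)) \<and> A > 0 \<and> B > 0 \<and>
     (\<forall>x. (\<lambda>i. (norm (G i x))\<^sup>2) summable_on I \<and>
          A * (norm x)\<^sup>2 \<le> (\<Sum>\<^sub>\<infinity>i\<in>I. (norm (G i x))\<^sup>2) \<and>
          (\<Sum>\<^sub>\<infinity>i\<in>I. (norm (G i x))\<^sup>2) \<le> B * (norm x)\<^sup>2)"

end

theory Submission
  imports Defs
begin

text \<open>
  Write \<open>S\<^sub>J\<close> and \<open>T\<^sub>J\<close> for the partial frame operators \<open>\<Sum>i\<in>J. G\<^sub>i\<^sup>* G\<^sub>i\<close> and \<open>\<Sum>i\<in>J. H\<^sub>i\<^sup>* H\<^sub>i\<close>. The weighted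
  inequality of arithmetic and geometric means makes the perturbation hypothesis linear: with
  \<open>p = \<alpha> \<lambda>\<^sub>1 + \<beta> \<lambda>\<^sub>2\<close> and \<open>q = \<beta> \<lambda>\<^sub>1 + \<alpha> \<lambda>\<^sub>2\<close>, both smaller than 1, it gives
  \<open>\<parallel>S\<^sub>J x - T\<^sub>J x\<parallel> \<le> p \<parallel>S\<^sub>J x\<parallel> + q \<parallel>T\<^sub>J x\<parallel>\<close>, and the triangle inequality then compares the two norms:
  \<open>(1 - q) \<parallel>T\<^sub>J x\<parallel> \<le> (1 + p) \<parallel>S\<^sub>J x\<parallel>\<close> and \<open>(1 - p) \<parallel>S\<^sub>J x\<parallel> \<le> (1 + q) \<parallel>T\<^sub>J x\<parallel>\<close>.

  A frame inequality is about the quadratic form \<open>\<langle>T x, x\<rangle> = (\<Sum>i\<in>I. \<parallel>H\<^sub>i x\<parallel>\<^sup>2)\<close>, not about \<open>\<parallel>T x\<parallel>\<close>. Towards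
  the upper bound this costs nothing: \<open>\<langle>T\<^sub>J x, x\<rangle> \<le> \<parallel>T\<^sub>J x\<parallel> \<parallel>x\<parallel>\<close>, and \<open>\<parallel>S\<^sub>J x\<parallel> \<le> B \<parallel>x\<parallel>\<close> because
  \<open>S\<^sub>J\<close> is positive with form bounded by \<open>B\<close> (lemma \<open>norm_positive_operator_le\<close>). The same lemma shows
  that the series of the \<open>H\<^sub>i\<^sup>* H\<^sub>i x\<close> converges in norm, which defines the frame operator \<open>T\<close>. The norm
  comparison passes to the limit and yields \<open>\<parallel>T x\<parallel> \<ge> m \<parallel>x\<parallel>\<close>, where \<open>m\<close> is the lower bound claimed.

  Getting back from the norm to the form is the point where positivity of \<open>T\<close> is essential
  (lemma \<open>positive_operator_form_ge\<close>). The infimum \<open>\<mu>\<close> of the form over the unit sphere is an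
  approximate eigenvalue, so there are unit vectors \<open>x\<close> with \<open>\<parallel>T x\<parallel>\<close> arbitrarily close to \<open>\<mu>\<close>, whence
  \<open>m \<le> \<mu>\<close>.
\<close>

section \<open>Positive symmetric operators\<close>

text \<open>
  This is the Cauchy-Schwarz inequality for the positive form \<open>\<langle>T x, y\<rangle>\<close> at \<open>y = T x\<close>. The proof
  evaluates the form at \<open>x - T x / K\<close>, where it is nonnegative. Symmetry on the whole space entails
  linearity and is the form in which linearity enters the computation.
\<close>

lemma norm_positive_operator_le:
  fixes T :: "'a::real_inner \<Rightarrow> 'a"
  assumes sym: "\<And>x y. inner (T x) y = inner x (T y)"
    and pos: "\<And>x. 0 \<le> inner (T x) x"
    and bound: "\<And>x. inner (T x) x \<le> K * (norm x)\<^sup>2"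
    and K: "K > 0"
  shows "(norm (T x))\<^sup>2 \<le> K * inner (T x) x"
proof -
  define v where "v = T x"
  define s where "s = 1 / K"
  have "0 \<le> inner (T (x - s *\<^sub>R v)) (x - s *\<^sub>R v)"
    by (rule pos)
  also have "\<dots> = inner (x - s *\<^sub>R v) (T (x - s *\<^sub>R v))"
    by (rule sym)
  also have "\<dots> = inner (T x) (x - s *\<^sub>R v) - s * inner (T v) (x - s *\<^sub>R v)"
    by (simp only: sym inner_diff_left inner_scaleR_left)
  also have "\<dots> = inner (T x) x - 2 * s * (norm v)\<^sup>2 + s\<^sup>2 * inner (T v) v"
    using sym[of v x] unfolding power2_norm_eq_inner
    by (simp add: inner_diff_right v_def[symmetric] power2_eq_square algebra_simps)
  also have "\<dots> \<le> inner (T x) x - 2 * s * (norm v)\<^sup>2 + s\<^sup>2 * (K * (norm v)\<^sup>2)"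
    by (intro add_left_mono mult_left_mono bound) simp
  also have "\<dots> = inner (T x) x - (norm v)\<^sup>2 / K"
    using K by (simp add: s_def power2_eq_square)
  finally show ?thesis
    using K by (simp add: v_def field_simps)
qed

text \<open>
  For the infimum \<open>\<mu>\<close> of the form on the unit sphere, \<open>T - \<mu>\<close> is again positive, so
  \<open>norm_positive_operator_le\<close> bounds \<open>\<parallel>T x - \<mu> x\<parallel>\<^sup>2\<close> by a multiple of \<open>\<langle>T x, x\<rangle> - \<mu>\<close>. The latter can be made
  arbitrarily small, and then \<open>\<parallel>T x\<parallel>\<close> is close to \<open>\<mu>\<close>; hence \<open>m \<le> \<mu>\<close>.
\<close>

lemma positive_operator_form_ge:
  fixes T :: "'a::real_inner \<Rightarrow> 'a"
  assumes sym: "\<And>x y. inner (T x) y = inner x (T y)"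
    and pos: "\<And>x. 0 \<le> inner (T x) x"
    and bound: "\<And>x. inner (T x) x \<le> K * (norm x)\<^sup>2"
    and K: "K > 0"
    and below: "\<And>x. m * norm x \<le> norm (T x)"
  shows "m * (norm x)\<^sup>2 \<le> inner (T x) x"
proof (cases "x = 0")
  case False
  define \<mu> where "\<mu> = (INF x\<in>sphere 0 1. inner (T x) x)"
  have unit: "(1 / norm y) *\<^sub>R y \<in> sphere 0 1" if "y \<noteq> 0" for y :: 'a
    using that by simp
  have ne: "(\<lambda>x. inner (T x) x) ` sphere 0 1 \<noteq> {}"
    using unit[OF False] by blast
  have homogeneous: "inner (T (r *\<^sub>R y)) (r *\<^sub>R y) = r\<^sup>2 * inner (T y) y" for r y
    using sym[of "r *\<^sub>R y" y] by (simp add: power2_eq_square inner_commute)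
  have \<mu>_le: "\<mu> * (norm y)\<^sup>2 \<le> inner (T y) y" for y
  proof (cases "y = 0")
    case False
    have "\<mu> \<le> inner (T ((1 / norm y) *\<^sub>R y)) ((1 / norm y) *\<^sub>R y)"
      unfolding \<mu>_def using pos unit[OF False] by (intro cINF_lower bdd_belowI2[of _ 0]) auto
    also have "\<dots> = inner (T y) y / (norm y)\<^sup>2"
      unfolding homogeneous by (simp add: power_divide)
    finally show ?thesis
      using False by (simp add: field_simps)
  qed simp
  have \<mu>_nonneg: "\<mu> \<ge> 0"
    unfolding \<mu>_def using ne pos by (intro cINF_greatest) auto
  have shifted: "(norm (T y - \<mu> *\<^sub>R y))\<^sup>2 \<le> K * inner (T y - \<mu> *\<^sub>R y) y" for y
  proof (rule norm_positive_operator_le)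
    show "inner (T z - \<mu> *\<^sub>R z) w = inner z (T w - \<mu> *\<^sub>R w)" for z w
      by (simp add: inner_diff_left inner_diff_right sym)
    show "0 \<le> inner (T z - \<mu> *\<^sub>R z) z" for z
      using \<mu>_le[of z] by (simp add: inner_diff_left power2_norm_eq_inner)
    have "0 \<le> \<mu> * inner z z" for z :: 'a
      using \<mu>_nonneg by simp
    then show "inner (T z - \<mu> *\<^sub>R z) z \<le> K * (norm z)\<^sup>2" for z
      using bound[of z] by (simp add: inner_diff_left add_increasing2 diff_le_eq)
  qed (rule K)
  have "m \<le> \<mu>"
  proof (rule ccontr)
    assume "\<not> m \<le> \<mu>"
    then have "\<mu> < \<mu> + (m - \<mu>)\<^sup>2 / K"
      using K by simp
    then obtain y where y: "norm y = 1" "inner (T y) y < \<mu> + (m - \<mu>)\<^sup>2 / K"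
      using cInf_lessD[OF ne, folded \<mu>_def] by fastforce
    have "(norm (T y - \<mu> *\<^sub>R y))\<^sup>2 \<le> K * (inner (T y) y - \<mu>)"
      using shifted[of y] y(1) by (simp add: inner_diff_left flip: power2_norm_eq_inner)
    also have "\<dots> < (m - \<mu>)\<^sup>2"
      using y(2) K by (simp add: field_simps)
    finally have "norm (T y - \<mu> *\<^sub>R y) < m - \<mu>"
      using \<open>\<not> m \<le> \<mu>\<close> by (intro power2_less_imp_less[of _ "m - \<mu>"]) auto
    moreover have "norm (T y) \<le> norm (T y - \<mu> *\<^sub>R y) + norm (\<mu> *\<^sub>R y)"
      using norm_triangle_ineq[of "T y - \<mu> *\<^sub>R y" "\<mu> *\<^sub>R y"] by simp
    ultimately show False
      using below[of y] y(1) \<mu>_nonneg by simp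
  qed
  then have "m * (norm x)\<^sup>2 \<le> \<mu> * (norm x)\<^sup>2"
    by (rule mult_right_mono) simp
  with \<mu>_le[of x] show ?thesis by linarith
qed simp

section \<open>Series of vectors\<close>

text \<open>
  The hypothesis applies in particular to finite sets that avoid a large finite set \<open>F\<close>; there the sums
  of \<open>b\<close> are small, so the partial sums of \<open>f\<close> form a Cauchy net. Absolute convergence of \<open>f\<close> may fail.
\<close>

lemma summable_on_of_norm_sum_dominated:
  fixes f :: "'i \<Rightarrow> 'a::{real_normed_vector, complete_space}" and b :: "'i \<Rightarrow> real"
  assumes b: "b summable_on A" "\<And>i. i \<in> A \<Longrightarrow> b i \<ge> 0"
    and dom: "\<And>F. finite F \<Longrightarrow> F \<subseteq> A \<Longrightarrow> (norm (sum f F))\<^sup>2 \<le> K * sum b F"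
    and K: "K > 0"
  shows "f summable_on A"
proof -
  have "\<exists>P. eventually P (finite_subsets_at_top A) \<and>
      (\<forall>F F'. P F \<and> P F' \<longrightarrow> dist (sum f F) (sum f F') < e)" if e: "e > 0" for e
  proof -
    define d where "d = (e / 2)\<^sup>2 / K"
    have d: "d > 0" using e K by (simp add: d_def)
    have "eventually (\<lambda>F. infsum b A - d < sum b F) (finite_subsets_at_top A)"
      using infsum_tendsto[OF b(1)] d by (intro order_tendstoD(1)) auto
    then obtain F where F: "finite F" "F \<subseteq> A" "infsum b A - d < sum b F"
      by (auto simp: eventually_finite_subsets_at_top)
    define P where "P X \<longleftrightarrow> finite X \<and> F \<subseteq> X \<and> X \<subseteq> A" for X
    have near: "dist (sum f X) (sum f F) < e / 2" if X: "P X" for X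
    proof -
      have "sum b X \<le> infsum b A"
        using b X by (intro finite_sum_le_infsum) (auto simp: P_def)
      then have "sum b (X - F) < d"
        using F X by (simp add: P_def sum_diff)
      have "(norm (sum f (X - F)))\<^sup>2 \<le> K * sum b (X - F)"
        using X by (intro dom) (auto simp: P_def)
      also have "\<dots> < K * d"
        using \<open>sum b (X - F) < d\<close> K by simp
      also have "\<dots> = (e / 2)\<^sup>2"
        using K by (simp add: d_def)
      finally have "norm (sum f (X - F)) < e / 2"
        using e by (intro power2_less_imp_less[of _ "e / 2"]) auto
      then show ?thesis
        using F X by (simp add: P_def sum_diff dist_norm)
    qed
    have "eventually P (finite_subsets_at_top A)"
      using F by (auto simp: P_def eventually_finite_subsets_at_top)
    moreover have "dist (sum f X) (sum f Y) < e" if "P X" "P Y" for X Y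
      by (rule dist_triangle_half_l[OF near[OF that(1)] near[OF that(2)]])
    ultimately show ?thesis by blast
  qed
  then have "cauchy_filter (filtermap (sum f) (finite_subsets_at_top A))"
    by (simp add: cauchy_filter_metric_filtermap)
  moreover have "complete (UNIV :: 'a set)"
    by (meson Cauchy_convergent UNIV_I complete_def convergent_def)
  ultimately obtain l where "(sum f \<longlongrightarrow> l) (finite_subsets_at_top A)"
    using complete_uniform[where S = UNIV] by (force simp add: filterlim_def)
  then show ?thesis
    unfolding summable_on_def has_sum_def by blast
qed

section \<open>Perturbation of frames\<close>

lemma weighted_geometric_le_arithmetic_mean:
  fixes a b :: real
  assumes "0 \<le> \<alpha>" "0 \<le> \<beta>" "\<alpha> + \<beta> = 1" "a \<ge> 0" "b \<ge> 0"
  shows "a powr \<alpha> * b powr \<beta> \<le> \<alpha> * a + \<beta> * b"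
  using assms Youngs_inequality_0[of \<alpha> \<beta> a b] by (cases "a = 0 \<or> b = 0") auto

lemma inner_cadjoint:
  fixes G :: "'a::chilbert_space \<Rightarrow> 'b::complex_inner"
  assumes "bounded_clinear G"
  shows "inner (cadjoint G (G x)) y = inner (G x) (G y)"
  using cinner_cadjoint[OF assms, of y "G x"] by (metis inner_commute inner_eq_Re_cinner)

lemma inner_sum_cadjoint:
  fixes G :: "'i \<Rightarrow> 'a::chilbert_space \<Rightarrow> 'b::complex_inner"
  assumes "\<And>i. i \<in> J \<Longrightarrow> bounded_clinear (G i)"
  shows "inner (\<Sum>i\<in>J. cadjoint (G i) (G i x)) y = (\<Sum>i\<in>J. inner (G i x) (G i y))"
  unfolding inner_sum_left by (intro sum.cong refl inner_cadjoint assms)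

lemma norm_sum_cadjoint_le:
  fixes G :: "'i \<Rightarrow> 'a::chilbert_space \<Rightarrow> 'b::complex_inner"
  assumes G: "\<And>i. i \<in> J \<Longrightarrow> bounded_clinear (G i)"
    and bound: "\<And>x. (\<Sum>i\<in>J. (norm (G i x))\<^sup>2) \<le> K * (norm x)\<^sup>2" and "K > 0"
  shows "(norm (\<Sum>i\<in>J. cadjoint (G i) (G i x)))\<^sup>2 \<le> K * (\<Sum>i\<in>J. (norm (G i x))\<^sup>2)"
proof -
  define S where "S x = (\<Sum>i\<in>J. cadjoint (G i) (G i x))" for x
  have S: "inner (S x) y = (\<Sum>i\<in>J. inner (G i x) (G i y))" for x y
    unfolding S_def using G by (rule inner_sum_cadjoint)
  have "(norm (S x))\<^sup>2 \<le> K * inner (S x) x"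
  proof (rule norm_positive_operator_le)
    show "inner (S x) y = inner x (S y)" for x y
      unfolding inner_commute[of x] S by (simp add: inner_commute)
  qed (use bound \<open>K > 0\<close> in \<open>simp_all add: S sum_nonneg power2_norm_eq_inner\<close>)
  then show ?thesis
    unfolding S by (simp add: S_def power2_norm_eq_inner)
qed

text \<open>
  The frame operator of a Bessel family, that is, of a family satisfying the upper frame inequality,
  exists as a norm limit and represents the form \<open>\<Sum>i\<in>I. \<langle>H\<^sub>i x, H\<^sub>i y\<rangle>\<close>. Norm convergence is what lets
  norm estimates for the partial frame operators pass to the limit.
\<close>

lemma bessel_frame_operator:
  fixes H :: "'i \<Rightarrow> 'a::chilbert_space \<Rightarrow> 'b::complex_inner"
  assumes H: "\<And>i. i \<in> I \<Longrightarrow> bounded_clinear (H i)"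
    and bound: "\<And>J x. finite J \<Longrightarrow> J \<subseteq> I \<Longrightarrow> (\<Sum>i\<in>J. (norm (H i x))\<^sup>2) \<le> K * (norm x)\<^sup>2"
    and K: "K > 0"
  obtains T where "\<And>x. ((\<lambda>i. cadjoint (H i) (H i x)) has_sum T x) I"
    and "\<And>x y. ((\<lambda>i. inner (H i x) (H i y)) has_sum inner (T x) y) I"
proof
  fix x
  have "(\<lambda>i. (norm (H i x))\<^sup>2) summable_on I"
    using bound by (intro nonneg_bdd_above_summable_on bdd_aboveI2[of _ _ "K * (norm x)\<^sup>2"]) auto
  then have "(\<lambda>i. cadjoint (H i) (H i x)) summable_on I"
    by (rule summable_on_of_norm_sum_dominated[where K = K])
      (use H bound K in \<open>auto intro!: norm_sum_cadjoint_le\<close>)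
  then show *: "((\<lambda>i. cadjoint (H i) (H i x)) has_sum infsum (\<lambda>i. cadjoint (H i) (H i x)) I) I"
    by simp
  fix y
  from * have "((\<lambda>i. inner (cadjoint (H i) (H i x)) y) has_sum
      inner (infsum (\<lambda>i. cadjoint (H i) (H i x)) I) y) I"
    by (rule has_sum_bounded_linear[OF bounded_linear_inner_left])
  then show "((\<lambda>i. inner (H i x) (H i y)) has_sum
      inner (infsum (\<lambda>i. cadjoint (H i) (H i x)) I) y) I"
    by (subst (asm) has_sum_cong[OF inner_cadjoint[OF H]])
qed

theorem theorem4p6:
  fixes I :: "'i set"
    and G H :: "'i \<Rightarrow> 'h::chilbert_space \<Rightarrow> 'k::chilbert_space hs"
    and A B \<alpha> \<beta> lambda1 lambda2 :: real
  assumes "separable_space (euclidean :: 'h topology)"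
    and "separable_space (euclidean :: 'k topology)"
    and "countable I"
    and "hs_frame I G A B"
    and "\<And>i. i \<in> I \<Longrightarrow> bounded_clinear (H i)"
    and "\<alpha> \<in> {0<..<1}" and "\<beta> \<in> {0<..<1}" and "\<alpha> + \<beta> = 1"
    and "lambda1 \<ge> 0" and "lambda2 \<ge> 0" and "max lambda1 lambda2 < 1"
    and "\<And>J x. finite J \<Longrightarrow> J \<subseteq> I \<Longrightarrow>
      norm (\<Sum>i\<in>J. cadjoint (G i) (G i x) - cadjoint (H i) (H i x))
        \<le> lambda1 * norm (\<Sum>i\<in>J. cadjoint (G i) (G i x)) powr \<alpha>
              * norm (\<Sum>i\<in>J. cadjoint (H i) (H i x)) powr \<beta>
          + lambda2 * norm (\<Sum>i\<in>J. cadjoint (G i) (G i x)) powr \<beta>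
              * norm (\<Sum>i\<in>J. cadjoint (H i) (H i x)) powr \<alpha>"
  shows "hs_frame I H
           (A * ((1 - \<alpha> * lambda1 - \<beta> * lambda2) / (1 + \<beta> * lambda1 + \<alpha> * lambda2)))
           (B * ((1 + \<alpha> * lambda1 + \<beta> * lambda2) / (1 - \<beta> * lambda1 - \<alpha> * lambda2)))"
proof -
  define p where "p = \<alpha> * lambda1 + \<beta> * lambda2"
  define q where "q = \<beta> * lambda1 + \<alpha> * lambda2"
  define S where "S J x = (\<Sum>i\<in>J. cadjoint (G i) (G i x))" for J x
  define T where "T J x = (\<Sum>i\<in>J. cadjoint (H i) (H i x))" for J x
  define C where "C = (1 + p) / (1 - q)"
  define c where "c = (1 - p) / (1 + q)"
  note \<alpha>\<beta> = \<open>\<alpha> \<in> {0<..<1}\<close> \<open>\<beta> \<in> {0<..<1}\<close> \<open>\<alpha> + \<beta> = 1\<close>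
  note \<open>lambda1 \<ge> 0\<close> \<open>lambda2 \<ge> 0\<close>
  have G: "bounded_clinear (G i)" if "i \<in> I" for i
    using \<open>hs_frame I G A B\<close> that by (simp add: hs_frame_def)
  have H: "bounded_clinear (H i)" if "i \<in> I" for i
    using that by fact
  have "A > 0" "B > 0"
    and G_summable: "\<And>x. (\<lambda>i. (norm (G i x))\<^sup>2) summable_on I"
    and G_lower: "\<And>x. A * (norm x)\<^sup>2 \<le> (\<Sum>\<^sub>\<infinity>i\<in>I. (norm (G i x))\<^sup>2)"
    and G_upper: "\<And>x. (\<Sum>\<^sub>\<infinity>i\<in>I. (norm (G i x))\<^sup>2) \<le> B * (norm x)\<^sup>2"
    using \<open>hs_frame I G A B\<close> by (auto simp: hs_frame_def)

  have convex_less_1: "a * lambda1 + b * lambda2 < 1" if "a > 0" "b > 0" "a + b = 1" for a b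
    using convex_bound_lt[of lambda1 1 lambda2 a b] that \<open>max lambda1 lambda2 < 1\<close> by simp
  have p: "0 \<le> p" "p < 1" and q: "0 \<le> q" "q < 1"
    using \<alpha>\<beta> \<open>lambda1 \<ge> 0\<close> \<open>lambda2 \<ge> 0\<close> convex_less_1[of \<alpha> \<beta>] convex_less_1[of \<beta> \<alpha>]
    by (simp_all add: p_def q_def)
  have "C > 0" "c > 0"
    using p q by (simp_all add: C_def c_def)

  have perturbation: "norm (S J x - T J x) \<le> p * norm (S J x) + q * norm (T J x)"
    if J: "finite J" "J \<subseteq> I" for J x
  proof -
    let ?s = "norm (S J x)" and ?t = "norm (T J x)"
    have "norm (S J x - T J x)
        \<le> lambda1 * ?s powr \<alpha> * ?t powr \<beta> + lambda2 * ?s powr \<beta> * ?t powr \<alpha>"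
      unfolding S_def T_def sum_subtractf[symmetric] using J by fact
    also have "\<dots> = lambda1 * (?s powr \<alpha> * ?t powr \<beta>) + lambda2 * (?s powr \<beta> * ?t powr \<alpha>)"
      by (simp add: mult.assoc)
    also have "\<dots> \<le> lambda1 * (\<alpha> * ?s + \<beta> * ?t) + lambda2 * (\<beta> * ?s + \<alpha> * ?t)"
      using \<alpha>\<beta> \<open>lambda1 \<ge> 0\<close> \<open>lambda2 \<ge> 0\<close>
      by (intro add_mono mult_left_mono weighted_geometric_le_arithmetic_mean) auto
    also have "\<dots> = p * ?s + q * ?t"
      by (simp add: p_def q_def algebra_simps)
    finally show ?thesis .
  qed
  have T_le: "norm (T J x) \<le> C * norm (S J x)" and T_ge: "c * norm (S J x) \<le> norm (T J x)"
    if J: "finite J" "J \<subseteq> I" for J x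
  proof -
    have "norm (T J x) \<le> norm (S J x) + norm (S J x - T J x)"
      and "norm (S J x) \<le> norm (T J x) + norm (S J x - T J x)"
      using norm_triangle_sub[of "T J x" "S J x"] norm_triangle_sub[of "S J x" "T J x"]
      by (simp_all add: norm_minus_commute)
    with perturbation[OF J, of x]
    have "(1 - q) * norm (T J x) \<le> (1 + p) * norm (S J x)"
      and "(1 - p) * norm (S J x) \<le> (1 + q) * norm (T J x)"
      by (simp_all add: algebra_simps)
    then show "norm (T J x) \<le> C * norm (S J x)" and "c * norm (S J x) \<le> norm (T J x)"
      using p q by (simp_all add: C_def c_def field_simps)
  qed

  have S_form: "inner (S J x) x = (\<Sum>i\<in>J. (norm (G i x))\<^sup>2)" if "J \<subseteq> I" for J x
    using inner_sum_cadjoint[of J G x x] G that by (auto simp: S_def power2_norm_eq_inner)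
  have T_form: "inner (T J x) x = (\<Sum>i\<in>J. (norm (H i x))\<^sup>2)" if "J \<subseteq> I" for J x
    using inner_sum_cadjoint[of J H x x] H that by (auto simp: T_def power2_norm_eq_inner)

  have S_le: "norm (S J x) \<le> B * norm x" if J: "finite J" "J \<subseteq> I" for J x
  proof -
    have le: "(\<Sum>i\<in>J. (norm (G i y))\<^sup>2) \<le> B * (norm y)\<^sup>2" for y
      using finite_sum_le_infsum[OF G_summable J, of y] G_upper[of y] by simp
    have "(norm (S J x))\<^sup>2 \<le> B * (\<Sum>i\<in>J. (norm (G i x))\<^sup>2)"
      unfolding S_def using G J le \<open>B > 0\<close> by (intro norm_sum_cadjoint_le) auto
    also have "\<dots> \<le> B * (B * (norm x)\<^sup>2)"
      using le \<open>B > 0\<close> by (intro mult_left_mono) auto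
    also have "\<dots> = (B * norm x)\<^sup>2"
      by (simp add: power2_eq_square)
    finally show ?thesis
      by (rule power2_le_imp_le) (use \<open>B > 0\<close> in simp)
  qed
  have H_bessel: "(\<Sum>i\<in>J. (norm (H i x))\<^sup>2) \<le> B * C * (norm x)\<^sup>2"
    if J: "finite J" "J \<subseteq> I" for J x
  proof -
    have "(\<Sum>i\<in>J. (norm (H i x))\<^sup>2) \<le> norm (T J x) * norm x"
      unfolding T_form[OF J(2), symmetric] by (rule norm_cauchy_schwarz)
    also have "\<dots> \<le> (C * norm (S J x)) * norm x"
      by (intro mult_right_mono T_le J) simp
    also have "\<dots> \<le> (C * (B * norm x)) * norm x"
      using \<open>C > 0\<close> by (intro mult_right_mono mult_left_mono S_le J) auto
    also have "\<dots> = B * C * (norm x)\<^sup>2"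
      by (simp add: power2_eq_square)
    finally show ?thesis .
  qed
  have "B * C > 0"
    using \<open>B > 0\<close> \<open>C > 0\<close> by simp
  \<comment> \<open>The limit \<open>U\<close> of the \<open>T J\<close> is the frame operator of \<open>H\<close>.\<close>
  with H H_bessel obtain U where U: "\<And>x. ((\<lambda>i. cadjoint (H i) (H i x)) has_sum U x) I"
    and U_form: "\<And>x y. ((\<lambda>i. inner (H i x) (H i y)) has_sum inner (U x) y) I"
    by (rule bessel_frame_operator) auto
  have U_quadratic: "((\<lambda>i. (norm (H i x))\<^sup>2) has_sum inner (U x) x) I" for x
    using U_form[of x x] by (simp add: power2_norm_eq_inner)
  have U_upper: "inner (U x) x \<le> B * C * (norm x)\<^sup>2" for x
    using U_quadratic H_bessel by (rule has_sum_le_finite_sums)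

  \<comment> \<open>For each finite \<open>J\<close>, the form of \<open>S J\<close> at \<open>x\<close> is at most \<open>norm (S J x) * norm x\<close>; in the limit it
    reaches the lower frame inequality of \<open>G\<close>.\<close>
  have U_below: "A * c * norm x \<le> norm (U x)" for x
  proof (cases "x = 0")
    case False
    have "c * (\<Sum>\<^sub>\<infinity>i\<in>I. (norm (G i x))\<^sup>2) \<le> norm (U x) * norm x"
    proof (rule tendsto_le)
      show "((\<lambda>J. norm (T J x) * norm x) \<longlongrightarrow> norm (U x) * norm x) (finite_subsets_at_top I)"
        using U[of x] unfolding has_sum_def T_def by (intro tendsto_intros)
      show "((\<lambda>J. c * (\<Sum>i\<in>J. (norm (G i x))\<^sup>2)) \<longlongrightarrow> c * (\<Sum>\<^sub>\<infinity>i\<in>I. (norm (G i x))\<^sup>2))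
          (finite_subsets_at_top I)"
        by (intro tendsto_intros infsum_tendsto G_summable)
      have "c * (\<Sum>i\<in>J. (norm (G i x))\<^sup>2) \<le> norm (T J x) * norm x"
        if J: "finite J" "J \<subseteq> I" for J
      proof -
        have "c * (\<Sum>i\<in>J. (norm (G i x))\<^sup>2) \<le> c * (norm (S J x) * norm x)"
          unfolding S_form[OF J(2), symmetric] using \<open>c > 0\<close>
          by (intro mult_left_mono norm_cauchy_schwarz) auto
        also have "\<dots> \<le> norm (T J x) * norm x"
          using mult_right_mono[OF T_ge[OF J, of x], of "norm x"] by (simp add: mult.assoc)
        finally show ?thesis .
      qed
      then show "\<forall>\<^sub>F J in finite_subsets_at_top I.
          c * (\<Sum>i\<in>J. (norm (G i x))\<^sup>2) \<le> norm (T J x) * norm x"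
        by (intro eventually_finite_subsets_at_top_weakI)
    qed simp
    moreover have "c * (A * (norm x)\<^sup>2) \<le> c * (\<Sum>\<^sub>\<infinity>i\<in>I. (norm (G i x))\<^sup>2)"
      using G_lower \<open>c > 0\<close> by (intro mult_left_mono) auto
    ultimately have "(A * c * norm x) * norm x \<le> norm (U x) * norm x"
      by (simp add: power2_eq_square mult_ac)
    then show ?thesis
      using False by simp
  qed simp
  have U_lower: "A * c * (norm x)\<^sup>2 \<le> inner (U x) x" for x
  proof (rule positive_operator_form_ge[where K = "B * C"])
    fix x y
    show "inner (U x) y = inner x (U y)"
      using has_sum_unique[OF U_form[of x y]] U_form[of y x] by (simp add: inner_commute)
    show "0 \<le> inner (U x) x"
      using U_quadratic by (rule has_sum_nonneg) simp
  qed (fact U_upper \<open>B * C > 0\<close> U_below)+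

  have "hs_frame I H (A * c) (B * C)"
    unfolding hs_frame_def
    using H \<open>A > 0\<close> \<open>c > 0\<close> \<open>B * C > 0\<close> U_lower U_upper U_quadratic
    by (simp add: infsumI[OF U_quadratic] has_sum_imp_summable[OF U_quadratic])
  then show ?thesis
    by (simp add: c_def C_def p_def q_def algebra_simps)
qed

end
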